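(* Let $M\in\mathbb{C}^{p\times p}$ be nonsingular, let $\mathcal{A}\in\mathbb{C}^{m\times m\times p}$ have tubal index $k$ with respect to $M$, and let $\mathcal{X}:=\mathcal{A}^{\mathrm{cep}}$ be its core-EP inverse. Then: (i) $\mathcal{A}*_M\mathcal{X}=\mathcal{A}^n*_M\mathcal{X}^n$ for every positive integer $n$; (ii) $\mathcal{X}=\mathcal{A}^n*_M\mathcal{X}^{n+1}$ for every positive integer $n$; (iii) $\mathcal{X}*_M\mathcal{A}*_M\mathcal{X}=\mathcal{X}$; (iv) $\mathcal{X}^{k+1}*_M\mathcal{A}^k=\mathcal{A}^{\mathrm D}$.
   Context: Transform: for $\mathcal{A}\in\mathbb{C}^{m\times n\times p}$, $\tilde{\mathcal{A}}=\mathcal{A}\times_3 M\in\mathbb{C}^{m\times n\times p}$ is given by $(\tilde{\mathcal{A}})_{ijk}=\sum_{s=1}^p(\mathcal{A})_{ijs}M_{ks}$, and $\tilde{\mathcal{A}}^{(i)}=\tilde{\mathcal{A}}(:,:,i)$ is its $i$th frontal slice. Since $M$ is nonsingular, $\mathcal{A}\mapsto\tilde{\mathcal{A}}$ is a bijection. $M$-product: for $\mathcal{A}\in\mathbb{C}^{m\times n\times p}$, $\mathcal{B}\in\mathbb{C}^{n\times l\times p}$, $\mathcal{A}*_M\mathcal{B}$ is the unique $\mathcal{C}\in\mathbb{C}^{m\times l\times p}$ with $\tilde{\mathcal{C}}^{(i)}=\tilde{\mathcal{A}}^{(i)}\tilde{\mathcal{B}}^{(i)}$, $i=1,\dots,p$.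 The identity tensor $\mathcal{I}$ has $\tilde{\mathcal{I}}^{(i)}=I_m$ for all $i$; powers are taken with respect to $*_M$, with $\mathcal{A}^0=\mathcal{I}$. The conjugate transpose $\mathcal{A}^*$ is the tensor whose transform has $i$th frontal slice $(\tilde{\mathcal{A}}^{(i)})^{*}$ (matrix conjugate transpose). Tubal index of $\mathcal{A}\in\mathbb{C}^{m\times m\times p}$: $k=\max_{1\le i\le p}\mathrm{ind}(\tilde{\mathcal{A}}^{(i)})$, where $\mathrm{ind}(A)$ is the least integer $k\ge 0$ with $\mathrm{rank}(A^k)=\mathrm{rank}(A^{k+1})$. Drazin inverse: for $\mathcal{A}$ of tubal index $k$, $\mathcal{A}^{\mathrm D}$ is the unique $\mathcal{Y}\in\mathbb{C}^{m\times m\times p}$ with $\mathcal{Y}*_M\mathcal{A}*_M\mathcal{Y}=\mathcal{Y}$, $\mathcal{A}*_M\mathcal{Y}=\mathcal{Y}*_M\mathcal{A}$ and $\mathcal{Y}*_M\mathcal{A}^{k+1}=\mathcal{A}^k$. Core-EP inverse: for $\mathcal{A}$ of tubal index $k$, $\mathcal{A}^{\mathrm{cep}}$ is the tensor $\mathcal{X}\in\mathbb{C}^{m\times m\times p}$ satisfying $\mathcal{X}*_M\mathcal{A}^{k+1}=\mathcal{A}^k$, $\mathcal{A}*_M\mathcal{X}^2=\mathcal{X}$ and $(\mathcal{A}*_M\mathcal{X})^*=\mathcal{A}*_M\mathcal{X}$. *)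

theory Defs
  imports "HOL-Analysis.Analysis"
begin

text \<open>A tensor in \<open>C^(m x n x p)\<close> has type \<open>complex^'p^'n^'m\<close> with \<open>m = CARD('m)\<close> etc.
  (note the reversed order); its entry at \<open>(i, j, k)\<close> is \<open>A $ i $ j $ k\<close>.\<close>

definition mode3_prod :: "complex^'p^'n^'m \<Rightarrow> complex^'p^'p \<Rightarrow> complex^'p^'n^'m" where
  "mode3_prod A M = (\<chi> i j k. \<Sum>s\<in>UNIV. A $ i $ j $ s * M $ k $ s)"

definition frontal_slice :: "complex^'p^'n^'m \<Rightarrow> 'p \<Rightarrow> complex^'n^'m" where
  "frontal_slice A k = (\<chi> i j. A $ i $ j $ k)"

definition tslice :: "complex^'p^'p \<Rightarrow> complex^'p^'n^'m \<Rightarrow> 'p \<Rightarrow> complex^'n^'m" where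
  "tslice M A i = frontal_slice (mode3_prod A M) i"

text \<open>The next lemma justifies the definite descriptions used for the product, the identity
  and the conjugate transpose: for nonsingular \<open>M\<close> a tensor is determined by, and can be
  prescribed through, the frontal slices of its transform.\<close>

lemma ex1_tslice:
  fixes M :: "complex^'p^'p" and F :: "'p \<Rightarrow> complex^'n^'m"
  assumes "invertible M"
  shows "\<exists>!C. \<forall>i. tslice M C i = F i"
proof -
  have eq: "(\<forall>k. tslice M C k = F k) \<longleftrightarrow> (\<forall>i j. M *v (C $ i $ j) = (\<chi> k. F k $ i $ j))"
    for C :: "complex^'p^'n^'m"
    by (auto simp: tslice_def frontal_slice_def mode3_prod_def matrix_vector_mult_def
        vec_eq_iff mult.commute)
  obtain N where N: "M ** N = mat 1" "N ** M = mat 1"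
    using assms by (auto simp: invertible_def)
  have inv: "M *v x = y \<longleftrightarrow> x = N *v y" for x y :: "complex^'p"
    using N by (metis matrix_vector_mul_assoc matrix_vector_mul_lid)
  show ?thesis
  proof (rule ex1I)
    let ?C = "(\<chi> i j. N *v (\<chi> k. F k $ i $ j)) :: complex^'p^'n^'m"
    show "\<forall>k. tslice M ?C k = F k"
      unfolding eq inv by simp
    show "D = ?C" if "\<forall>k. tslice M D k = F k" for D
      using that unfolding eq inv by (simp add: vec_eq_iff)
  qed
qed

definition mprod ::
  "complex^'p^'p \<Rightarrow> complex^'p^'n^'m \<Rightarrow> complex^'p^'l^'n \<Rightarrow> complex^'p^'l^'m" where
  "mprod M A B = (THE C. \<forall>i. tslice M C i = tslice M A i ** tslice M B i)"

abbreviation mprod_infix ::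
  "complex^'p^'n^'m \<Rightarrow> complex^'p^'p \<Rightarrow> complex^'p^'l^'n \<Rightarrow> complex^'p^'l^'m"
  ("_ \<star>\<^bsub>_\<^esub> _" [70, 0, 71] 70) where
  "A \<star>\<^bsub>M\<^esub> B \<equiv> mprod M A B"

definition tensor_id :: "complex^'p^'p \<Rightarrow> complex^'p^'m^'m" where
  "tensor_id M = (THE C. \<forall>i. tslice M C i = mat 1)"

primrec tensor_pow :: "complex^'p^'p \<Rightarrow> complex^'p^'m^'m \<Rightarrow> nat \<Rightarrow> complex^'p^'m^'m" where
  "tensor_pow M A 0 = tensor_id M"
| "tensor_pow M A (Suc n) = A \<star>\<^bsub>M\<^esub> tensor_pow M A n"

definition mat_conj_transpose :: "complex^'n^'m \<Rightarrow> complex^'m^'n" where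
  "mat_conj_transpose A = (\<chi> i j. cnj (A $ j $ i))"

definition tensor_conj_transpose ::
  "complex^'p^'p \<Rightarrow> complex^'p^'n^'m \<Rightarrow> complex^'p^'m^'n" where
  "tensor_conj_transpose M A = (THE C. \<forall>i. tslice M C i = mat_conj_transpose (tslice M A i))"

text \<open>The library's power operation on \<open>complex^'m^'m\<close> would be componentwise, hence a separate
  matrix power.\<close>

primrec mat_pow :: "complex^'m^'m \<Rightarrow> nat \<Rightarrow> complex^'m^'m" where
  "mat_pow A 0 = mat 1"
| "mat_pow A (Suc n) = A ** mat_pow A n"

definition mat_index :: "complex^'m^'m \<Rightarrow> nat" where
  "mat_index A = (LEAST k. rank (mat_pow A k) = rank (mat_pow A (k + 1)))"

definition tubal_index :: "complex^'p^'p \<Rightarrow> complex^'p^'m^'m \<Rightarrow> nat" where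
  "tubal_index M A = Max (range (\<lambda>i. mat_index (tslice M A i)))"

definition is_drazin_inverse ::
  "complex^'p^'p \<Rightarrow> complex^'p^'m^'m \<Rightarrow> complex^'p^'m^'m \<Rightarrow> bool" where
  "is_drazin_inverse M A Y \<longleftrightarrow> (let k = tubal_index M A in
     Y \<star>\<^bsub>M\<^esub> A \<star>\<^bsub>M\<^esub> Y = Y \<and>
     A \<star>\<^bsub>M\<^esub> Y = Y \<star>\<^bsub>M\<^esub> A \<and>
     Y \<star>\<^bsub>M\<^esub> tensor_pow M A (k + 1) = tensor_pow M A k)"

definition drazin_inverse :: "complex^'p^'p \<Rightarrow> complex^'p^'m^'m \<Rightarrow> complex^'p^'m^'m" where
  "drazin_inverse M A = (THE Y. is_drazin_inverse M A Y)"

definition is_core_ep_inverse ::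
  "complex^'p^'p \<Rightarrow> complex^'p^'m^'m \<Rightarrow> complex^'p^'m^'m \<Rightarrow> bool" where
  "is_core_ep_inverse M A X \<longleftrightarrow> (let k = tubal_index M A in
     X \<star>\<^bsub>M\<^esub> tensor_pow M A (k + 1) = tensor_pow M A k \<and>
     A \<star>\<^bsub>M\<^esub> tensor_pow M X 2 = X \<and>
     tensor_conj_transpose M (A \<star>\<^bsub>M\<^esub> X) = A \<star>\<^bsub>M\<^esub> X)"

definition core_ep_inverse :: "complex^'p^'p \<Rightarrow> complex^'p^'m^'m \<Rightarrow> complex^'p^'m^'m" where
  "core_ep_inverse M A = (THE X. is_core_ep_inverse M A X)"

end

theory Submission
  imports Defs
begin

text \<open>The frontal slices of the transform turn \<open>\<star>\<^bsub>M\<^esub>\<close>, powers and the conjugate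
  transpose into the same operations on matrices, slice by slice, and a tensor is determined by
  these slices. So everything reduces to square complex matrices \<open>A\<close>, with one and the same
  exponent \<open>k\<close>, at least the index of each slice, in all defining equations.

  For matrices the identities are a calculation. From \<open>A X\<^sup>2 = X\<close> one gets
  \<open>A\<^sup>n X\<^bsup>n+1\<^esup> = X\<close> by iterating, which gives the first two identities;
  dually \<open>X A\<^bsup>k+1\<^esup> = A\<^sup>k\<close> gives \<open>X\<^sup>j A\<^bsup>k+j\<^esup> = A\<^sup>k\<close>. Writing
  \<open>X = A\<^sup>k X\<^bsup>k+1\<^esup>\<close> and cancelling shows \<open>X A X = X\<close>, and the same two rules show that
  \<open>X\<^bsup>k+1\<^esup> A\<^sup>k\<close> satisfies the Drazin equations.

  The two inverses are defined by definite descriptions, so both need uniqueness, and the core-EP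
  inverse needs existence as well. Uniqueness is algebra: \<open>A X\<close> is a Hermitian idempotent, two
  candidates have \<open>A X\<close> and \<open>A Y\<close> with the same range, hence equal, and then
  \<open>X = Y\<close>. Existence needs linear algebra: for \<open>k\<close> at least the index, \<open>A\<close> maps the range of
  \<open>A\<^sup>k\<close> bijectively onto itself, so \<open>V A\<^bsup>k+1\<^esup> = A\<^sup>k = A\<^bsup>k+1\<^esup> W\<close>
  are both solvable (lemma \<open>strongly_pi_regular\<close>). Then \<open>A\<^sup>k W\<^bsup>k+1\<^esup>\<close> inverts
  \<open>A\<close> on that range, and composing it with the orthogonal projector onto the range (lemma
  \<open>ex_orthogonal_projector\<close>) is the core-EP inverse.\<close>

section \<open>Solving matrix equations by range and rank\<close>

lemma span_columns_eq_range:
  fixes A :: "'a::field^'n^'m"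
  shows "vec.span (columns A) = range ((*v) A)"
proof -
  have "A *v axis i 1 = column i A" for i
    by (simp add: vec_eq_iff matrix_vector_mult_def column_def axis_def if_distrib cong: if_cong)
  then have "columns A = (*v) A ` range (\<lambda>i. axis i 1)"
    by (auto simp: columns_def image_image)
  also have "range (\<lambda>i. axis i 1) = (cart_basis :: ('a^'n) set)"
    by (auto simp: cart_basis_def)
  finally have "columns A = (*v) A ` cart_basis" .
  then show ?thesis
    by (simp add: vec.span_image span_cart_basis)
qed

lemma subspace_range_matrix:
  fixes A :: "'a::field^'n^'m"
  shows "vec.subspace (range ((*v) A))"
  by (metis span_columns_eq_range vec.subspace_span)

lemma ex_right_factor_iff_range_subset:
  fixes C :: "'a::field^'l^'m" and D :: "'a^'n^'m"
  shows "(\<exists>W. D ** W = C) \<longleftrightarrow> range ((*v) C) \<subseteq> range ((*v) D)"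
proof
  show "range ((*v) C) \<subseteq> range ((*v) D)" if "\<exists>W. D ** W = C"
    using that by (auto simp flip: matrix_vector_mul_assoc)
  assume sub: "range ((*v) C) \<subseteq> range ((*v) D)"
  obtain g where lin: "Vector_Spaces.linear (*s) (*s) g" and g: "\<And>v. v \<in> range ((*v) D) \<Longrightarrow> D *v g v = v"
    using vec.linear_exists_right_inverse_on[OF matrix_vector_mul_linear_gen vec.subspace_UNIV, of D]
    by blast
  have "D *v (matrix g *v (C *v x)) = C *v x" for x
    using sub g by (auto simp: matrix_works[OF lin])
  then have "D ** (matrix g ** C) = C"
    by (simp add: matrix_eq flip: matrix_vector_mul_assoc)
  then show "\<exists>W. D ** W = C" by blast
qed

lemma ex_inner_inverse:
  fixes A :: "'a::field^'n^'m"
  obtains G where "A ** G ** A = A"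
proof -
  obtain g where lin: "Vector_Spaces.linear (*s) (*s) g" and g: "\<And>v. v \<in> range ((*v) A) \<Longrightarrow> A *v g v = v"
    using vec.linear_exists_right_inverse_on[OF matrix_vector_mul_linear_gen vec.subspace_UNIV, of A]
    by blast
  have "A ** matrix g ** A = A"
    using g by (simp add: matrix_eq matrix_works[OF lin] flip: matrix_vector_mul_assoc)
  then show ?thesis by (rule that)
qed

lemma rank_eq_dim_range_transpose:
  fixes A :: "'a::field^'n^'m"
  shows "rank A = vec.dim (range ((*v) (transpose A)))"
  unfolding row_rank_def_gen by (metis columns_transpose span_columns_eq_range vec.dim_span)

lemma range_transpose_mult_subset:
  fixes P :: "'a::field^'m^'l" and B :: "'a^'n^'m"
  shows "range ((*v) (transpose (P ** B))) \<subseteq> range ((*v) (transpose B))"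
  by (auto simp: matrix_transpose_mul simp flip: matrix_vector_mul_assoc)

lemma rank_mult_le_right:
  fixes P :: "'a::field^'m^'l" and B :: "'a^'n^'m"
  shows "rank (P ** B) \<le> rank B"
  unfolding rank_eq_dim_range_transpose by (rule vec.dim_subset[OF range_transpose_mult_subset])

text \<open>Equal rank means equal row space, and every row of \<open>B\<close> in the row space of
  \<open>P B\<close> is what a left factor \<open>V\<close> records.\<close>

lemma ex_left_factor_if_rank_eq:
  fixes P :: "'a::field^'m^'l" and B :: "'a^'n^'m"
  assumes "rank (P ** B) = rank B"
  obtains V where "V ** (P ** B) = B"
proof -
  have "range ((*v) (transpose (P ** B))) = range ((*v) (transpose B))"
    using assms range_transpose_mult_subset[of P B] unfolding rank_eq_dim_range_transpose
    by (intro vec.subspace_dim_equal subspace_range_matrix) simp_all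
  then obtain W where "transpose (P ** B) ** W = transpose B"
    using ex_right_factor_iff_range_subset by blast
  then have "transpose W ** (P ** B) = B"
    by (metis matrix_transpose_mul transpose_transpose)
  then show ?thesis by (rule that)
qed

section \<open>Matrix powers and the index\<close>

lemma mat_pow_add: "mat_pow A (m + n) = mat_pow A m ** mat_pow A n"
  by (induction m) (simp_all add: matrix_mul_assoc)

lemma mat_pow_Suc_right: "mat_pow A (Suc n) = mat_pow A n ** A"
  using mat_pow_add[of A n 1] by simp

lemma mat_pow_two: "mat_pow A 2 = A ** A"
  by (simp add: numeral_2_eq_2)

lemma mat_pow_commute: "A ** mat_pow A n = mat_pow A n ** A"
  using mat_pow_Suc_right[of A n] by simp

text \<open>The ranks of the powers decrease, so they must repeat and the index is attained.\<close>

lemma rank_mat_pow_index: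
  "rank (mat_pow A (mat_index A)) = rank (mat_pow A (mat_index A + 1))"
  unfolding mat_index_def
proof (rule LeastI_ex, rule ccontr)
  assume contra: "\<nexists>k. rank (mat_pow A k) = rank (mat_pow A (k + 1))"
  have "rank (mat_pow A (Suc k)) < rank (mat_pow A k)" for k
    using contra rank_mult_le_right[of A "mat_pow A k"] by (metis Suc_eq_plus1 le_neq_implies_less mat_pow.simps(2))
  then show False
    using wf_no_infinite_down_chainE[OF wf_less_than, of "\<lambda>k. rank (mat_pow A k)"] by auto
qed

text \<open>The left equation says that \<open>A\<close> is injective on the range of the power; this range is
  finite-dimensional and mapped into itself, so \<open>A\<close> is onto it, which is the right
  equation. Multiplying by further powers of \<open>A\<close> reaches every exponent beyond the index.\<close>

lemma strongly_pi_regular: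
  assumes "mat_index A \<le> k"
  obtains V W where "V ** mat_pow A (Suc k) = mat_pow A k" and "mat_pow A (Suc k) ** W = mat_pow A k"
proof -
  define d where "d = mat_index A"
  let ?R = "range ((*v) (mat_pow A d))"
  obtain j where k: "k = d + j" using assms by (metis d_def le_add_diff_inverse)
  obtain V where V: "V ** mat_pow A (Suc d) = mat_pow A d"
    using ex_left_factor_if_rank_eq[of A "mat_pow A d"] rank_mat_pow_index[of A]
    by (auto simp: d_def)
  have left_inverse: "V *v (A *v y) = y" if y: "y \<in> ?R" for y
  proof -
    obtain x where "y = mat_pow A d *v x" using y by blast
    then show ?thesis using V by (simp add: matrix_vector_mul_assoc matrix_mul_assoc)
  qed
  have "inj_on ((*v) A) ?R"
    by (rule inj_on_inverseI[of _ "(*v) V"]) (use left_inverse in auto)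
  moreover have sub: "vec.subspace ?R"
    by (rule subspace_range_matrix)
  moreover have "vec.span ?R = ?R"
    using sub by (simp only: vec.span_eq_iff)
  ultimately have "vec.dim ((*v) A ` ?R) = vec.dim ?R"
    by (intro vec.dim_image_eq matrix_vector_mul_linear_gen) (simp only:)
  moreover have "(*v) A ` ?R \<subseteq> ?R"
  proof -
    have "A *v (mat_pow A d *v x) = mat_pow A d *v (A *v x)" for x
      by (simp only: matrix_vector_mul_assoc mat_pow_commute)
    then show ?thesis by auto
  qed
  moreover have "vec.subspace ((*v) A ` ?R)"
    using sub by (rule vec.subspace_image)
  ultimately have "(*v) A ` ?R = ?R"
    using sub by (intro vec.subspace_dim_equal) auto
  then have "range ((*v) (mat_pow A (Suc d))) = ?R"
    by (simp add: image_image matrix_vector_mul_assoc)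
  then obtain W where W: "mat_pow A (Suc d) ** W = mat_pow A d"
    using ex_right_factor_iff_range_subset by blast
  have "V ** mat_pow A (Suc k) = mat_pow A k"
    using V by (metis k add_Suc mat_pow_add matrix_mul_assoc)
  moreover have "mat_pow A (Suc k) ** W = mat_pow A k"
    using W by (metis k add.commute add_Suc mat_pow_add matrix_mul_assoc)
  ultimately show ?thesis by (rule that)
qed

section \<open>Conjugate transpose and orthogonal projectors\<close>

lemma mat_conj_transpose_mult:
  "mat_conj_transpose (A ** B) = mat_conj_transpose B ** mat_conj_transpose A"
  by (simp add: mat_conj_transpose_def matrix_matrix_mult_def vec_eq_iff mult.commute)

lemma mat_conj_transpose_idem [simp]: "mat_conj_transpose (mat_conj_transpose A) = A"
  by (simp add: mat_conj_transpose_def vec_eq_iff)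

lemma mat_conj_transpose_mult_self_eq_0:
  assumes "mat_conj_transpose E ** E = 0"
  shows "E = 0"
proof -
  have "(\<Sum>i\<in>UNIV. (cmod (E $ i $ j))\<^sup>2) = 0" for j
  proof -
    have "(\<Sum>i\<in>UNIV. cnj (E $ i $ j) * E $ i $ j) = 0"
      using assms by (simp add: mat_conj_transpose_def matrix_matrix_mult_def vec_eq_iff)
    then have "complex_of_real (\<Sum>i\<in>UNIV. (cmod (E $ i $ j))\<^sup>2) = 0"
      by (simp only: of_real_sum complex_norm_square mult.commute)
    then show ?thesis by (simp only: of_real_eq_0_iff)
  qed
  then show ?thesis
    by (simp add: sum_nonneg_eq_0_iff vec_eq_iff)
qed

lemma matrix_mult_diff_right:
  fixes A :: "'a::ring_1^'n^'m"
  shows "A ** (B - C) = A ** B - A ** C"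
  by (simp add: matrix_matrix_mult_def vec_eq_iff right_diff_distrib sum_subtractf)

text \<open>An inner inverse of \<open>B\<^sup>* B\<close> can be cancelled down to \<open>B\<close> because the
  error \<open>E\<close> is annihilated by \<open>B\<^sup>*\<close> while its columns lie in the range of
  \<open>B\<close>, so it is orthogonal to itself.\<close>

lemma mult_inner_inverse_gram:
  fixes B :: "complex^'n^'m"
  defines "S \<equiv> mat_conj_transpose B ** B"
  assumes G: "S ** G ** S = S"
  shows "B ** G ** mat_conj_transpose B ** B = B"
proof -
  let ?E = "B ** (G ** S - mat 1)"
  have "mat_conj_transpose B ** ?E = S ** G ** S - S"
    by (simp add: S_def matrix_mul_assoc matrix_mult_diff_right)
  then have "mat_conj_transpose B ** ?E = 0"
    using G by simp
  moreover have "mat_conj_transpose ?E ** ?E =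
      mat_conj_transpose (G ** S - mat 1) ** (mat_conj_transpose B ** ?E)"
    by (simp only: mat_conj_transpose_mult matrix_mul_assoc)
  ultimately have "mat_conj_transpose ?E ** ?E = 0" by simp
  then have "?E = 0" by (rule mat_conj_transpose_mult_self_eq_0)
  then show ?thesis
    by (simp add: S_def matrix_mult_diff_right matrix_mul_assoc)
qed

lemma ex_orthogonal_projector:
  fixes B :: "complex^'n^'m"
  obtains Z where "B ** Z ** B = B" and "mat_conj_transpose (B ** Z) = B ** Z"
proof -
  let ?h = mat_conj_transpose
  define S where "S = ?h B ** B"
  obtain G where G: "S ** G ** S = S" by (rule ex_inner_inverse)
  have "?h S = S" by (simp add: S_def mat_conj_transpose_mult)
  \<comment> \<open>Since \<open>S\<close> is Hermitian, the conjugate transpose of an inner inverse is again one.\<close>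
  then have G': "S ** ?h G ** S = S"
    using arg_cong[OF G, of ?h] by (simp add: mat_conj_transpose_mult matrix_mul_assoc)
  define P where "P = B ** G ** ?h B"
  have PB: "P ** B = B"
    using mult_inner_inverse_gram[of B G] G by (simp add: P_def S_def)
  have hPB: "?h P ** B = B"
    using mult_inner_inverse_gram[of B "?h G"] G'
    by (simp add: P_def S_def mat_conj_transpose_mult matrix_mul_assoc)
  have "?h P ** P = P"
    using hPB by (simp add: P_def matrix_mul_assoc)
  then have "?h P = P"
    by (metis mat_conj_transpose_idem mat_conj_transpose_mult)
  then show ?thesis
    using that[of "G ** ?h B"] PB by (simp add: P_def matrix_mul_assoc)
qed

section \<open>Core-EP and Drazin inverses of matrices\<close>

text \<open>The exponent \<open>k\<close> is a parameter and not the index of \<open>A\<close>, because the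
  slices of a tensor share the tubal index, which may exceed their own indices.\<close>

definition core_ep_at :: "nat \<Rightarrow> complex^'m^'m \<Rightarrow> complex^'m^'m \<Rightarrow> bool" where
  "core_ep_at k A X \<longleftrightarrow> X ** mat_pow A (Suc k) = mat_pow A k \<and> A ** mat_pow X 2 = X \<and>
     mat_conj_transpose (A ** X) = A ** X"

definition drazin_at :: "nat \<Rightarrow> complex^'m^'m \<Rightarrow> complex^'m^'m \<Rightarrow> bool" where
  "drazin_at k A Y \<longleftrightarrow> Y ** A ** Y = Y \<and> A ** Y = Y ** A \<and>
     Y ** mat_pow A (Suc k) = mat_pow A k"

lemma mat_pow_mult_mat_pow_Suc:
  assumes "A ** mat_pow X 2 = X"
  shows "mat_pow A n ** mat_pow X (Suc n) = X"
proof (induction n)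
  case (Suc n)
  have "mat_pow A (Suc n) ** mat_pow X (Suc (Suc n)) = mat_pow A n ** (A ** mat_pow X 2) ** mat_pow X n"
    by (simp only: mat_pow_Suc_right[of A n] mat_pow.simps(2)[of X] mat_pow_two matrix_mul_assoc)
  also have "\<dots> = X"
    using Suc assms by (simp add: matrix_mul_assoc)
  finally show ?case .
qed simp

lemma mult_eq_mat_pow_mult_mat_pow:
  assumes "A ** mat_pow X 2 = X" and "n > 0"
  shows "mat_pow A n ** mat_pow X n = A ** X"
proof -
  obtain j where "n = Suc j" using assms(2) gr0_conv_Suc by blast
  then show ?thesis
    using mat_pow_mult_mat_pow_Suc[OF assms(1), of j] by (simp flip: matrix_mul_assoc)
qed

lemma mat_pow_cancel_left:
  assumes "X ** mat_pow A (Suc k) = mat_pow A k"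
  shows "mat_pow X j ** mat_pow A (k + j) = mat_pow A k"
proof (induction j)
  case (Suc j)
  have "mat_pow X (Suc j) ** mat_pow A (k + Suc j) = mat_pow X j ** (X ** mat_pow A (Suc k)) ** mat_pow A j"
    by (metis add_Suc_right add_Suc mat_pow_Suc_right mat_pow_add matrix_mul_assoc)
  also have "\<dots> = mat_pow A k"
    using Suc assms by (simp add: mat_pow_add matrix_mul_assoc)
  finally show ?case .
qed simp

lemma core_ep_at_outer:
  assumes "core_ep_at k A X"
  shows "X ** A ** X = X"
proof -
  have *: "mat_pow A k ** mat_pow X (Suc k) = X"
    using assms by (intro mat_pow_mult_mat_pow_Suc) (simp add: core_ep_at_def)
  have "X ** A ** X = X ** A ** (mat_pow A k ** mat_pow X (Suc k))" using * by simp
  also have "\<dots> = (X ** mat_pow A (Suc k)) ** mat_pow X (Suc k)" by (simp add: matrix_mul_assoc)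
  also have "\<dots> = X" using * assms by (simp add: core_ep_at_def)
  finally show ?thesis .
qed

text \<open>\<open>A Y\<close> fixes the range of \<open>A\<^sup>k\<close>, which contains that of \<open>A X\<close>.\<close>

lemma core_ep_at_projector_absorb:
  assumes X: "core_ep_at k A X" and Y: "core_ep_at k A Y"
  shows "A ** Y ** (A ** X) = A ** X"
proof -
  have AX: "A ** X = mat_pow A (Suc k) ** mat_pow X (Suc k)"
    using X by (intro mult_eq_mat_pow_mult_mat_pow[symmetric]) (auto simp: core_ep_at_def)
  have "A ** Y ** (A ** X) = A ** (Y ** mat_pow A (Suc k)) ** mat_pow X (Suc k)"
    by (simp only: AX matrix_mul_assoc)
  also have "\<dots> = A ** X" using Y AX by (simp add: core_ep_at_def)
  finally show ?thesis .
qed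

text \<open>By absorption in both orders the Hermitian matrices \<open>A X\<close> and \<open>A Y\<close> have the
  same range; the conjugate transpose swaps the factors of \<open>A Y A X\<close>, so the two
  coincide. Then \<open>X = X A X = X A Y\<close>, and \<open>X\<close> cancels one \<open>A\<close> from the power
  of \<open>A\<close> in front of \<open>Y\<close>.\<close>

lemma core_ep_at_unique:
  assumes X: "core_ep_at k A X" and Y: "core_ep_at k A Y"
  shows "X = Y"
proof -
  have "A ** X = mat_conj_transpose (A ** Y ** (A ** X))"
    using X by (simp only: core_ep_at_projector_absorb[OF X Y] core_ep_at_def)
  also have "\<dots> = A ** X ** (A ** Y)"
    using X Y by (simp only: mat_conj_transpose_mult[of "A ** Y"] core_ep_at_def)
  also have "\<dots> = A ** Y"
    by (rule core_ep_at_projector_absorb[OF Y X])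
  finally have AX: "A ** X = A ** Y" .
  have "X = X ** (A ** Y)"
    using core_ep_at_outer[OF X] AX by (simp flip: matrix_mul_assoc)
  also have "A ** Y = mat_pow A (Suc k) ** mat_pow Y (Suc k)"
    using Y by (intro mult_eq_mat_pow_mult_mat_pow[symmetric]) (auto simp: core_ep_at_def)
  also have "X ** \<dots> = mat_pow A k ** mat_pow Y (Suc k)"
    using X by (simp only: matrix_mul_assoc core_ep_at_def)
  also have "\<dots> = Y"
    using Y by (intro mat_pow_mult_mat_pow_Suc) (simp add: core_ep_at_def)
  finally show ?thesis .
qed

lemma mat_pow_cancel_right:
  assumes "mat_pow A (Suc k) ** W = mat_pow A k"
  shows "mat_pow A (k + j) ** mat_pow W j = mat_pow A k"
proof (induction j)
  case (Suc j)
  have "mat_pow A (k + Suc j) ** mat_pow W (Suc j) = mat_pow A j ** (mat_pow A (Suc k) ** W) ** mat_pow W j"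
    by (metis add.commute add_Suc_right mat_pow.simps(2) mat_pow_add matrix_mul_assoc)
  also have "\<dots> = mat_pow A k"
    using Suc assms by (metis add.commute mat_pow_add)
  finally show ?case .
qed simp

lemma ex_core_ep_at:
  assumes "mat_index A \<le> k"
  shows "\<exists>X. core_ep_at k A X"
proof -
  let ?B = "mat_pow A k"
  obtain V W where V: "V ** mat_pow A (Suc k) = ?B" and W: "mat_pow A (Suc k) ** W = ?B"
    using strongly_pi_regular[OF assms] .
  obtain Z where Z: "?B ** Z ** ?B = ?B" and herm: "mat_conj_transpose (?B ** Z) = ?B ** Z"
    by (rule ex_orthogonal_projector)
  \<comment> \<open>\<open>D\<close> inverts \<open>A\<close> on the range of \<open>A\<^sup>k\<close>: by the choice of \<open>W\<close>,
    \<open>A\<^sup>k A D = A\<^sup>k\<close>, and \<open>V\<^sup>k\<close> cancels the outer \<open>A\<^sup>k\<close> because the columns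
    of \<open>A D\<close> lie in that range already.\<close>
  define D where "D = ?B ** mat_pow W (Suc k)"
  have AD: "A ** D ** ?B = ?B"
  proof -
    have "mat_pow A (k + Suc k) ** mat_pow W (Suc k) = ?B"
      using W by (rule mat_pow_cancel_right)
    then have AB: "?B ** (A ** D) = ?B"
      by (simp only: D_def mat_pow_add[of A k "Suc k"] mat_pow.simps(2)[of A] matrix_mul_assoc)
    have "mat_pow V k ** ?B ** ?B = ?B"
      using mat_pow_cancel_left[OF V, of k] by (simp add: mat_pow_add matrix_mul_assoc)
    moreover have "A ** D = ?B ** (A ** mat_pow W (Suc k))"
      by (simp only: D_def matrix_mul_assoc mat_pow_commute)
    ultimately have "A ** D = mat_pow V k ** ?B ** (A ** D)"
      by (metis matrix_mul_assoc)
    also have "\<dots> = mat_pow V k ** ?B"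
      using AB by (simp flip: matrix_mul_assoc)
    finally show ?thesis using \<open>mat_pow V k ** ?B ** ?B = ?B\<close> by simp
  qed
  have VD: "V ** A ** D = D"
    using V by (simp add: D_def matrix_mul_assoc)
  have DV: "D ** ?B = V ** ?B"
    using VD AD by (metis matrix_mul_assoc)
  define X where "X = D ** (?B ** Z)"
  have AX: "A ** X = ?B ** Z"
    using AD by (simp add: X_def matrix_mul_assoc)
  have "X ** mat_pow A (Suc k) = D ** (?B ** Z ** ?B) ** A"
    by (simp only: X_def mat_pow_Suc_right matrix_mul_assoc)
  also have "\<dots> = V ** mat_pow A (Suc k)"
    using DV Z by (simp add: mat_pow_commute matrix_mul_assoc)
  also have "\<dots> = ?B" by (rule V)
  finally have "X ** mat_pow A (Suc k) = ?B" .
  moreover have "A ** mat_pow X 2 = X"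
  proof -
    have "A ** mat_pow X 2 = (?B ** Z ** ?B) ** mat_pow W (Suc k) ** (?B ** Z)"
      by (simp only: mat_pow_two matrix_mul_assoc AX) (simp only: X_def D_def matrix_mul_assoc)
    then show ?thesis using Z by (simp add: X_def D_def)
  qed
  ultimately show ?thesis
    using herm AX by (auto simp: core_ep_at_def)
qed

text \<open>\<open>X\<close> need not commute with \<open>A\<close>, but it inverts \<open>A\<close> on the range of
  \<open>A\<^sup>k\<close>, and the trailing factor \<open>A\<^sup>k\<close> confines everything to this range. The
  power \<open>k + 1\<close> of \<open>X\<close> undoes that factor and contributes one further inverse.\<close>

lemma core_ep_at_imp_drazin_at:
  assumes X: "core_ep_at k A X"
  shows "drazin_at k A (mat_pow X (Suc k) ** mat_pow A k)"
proof -
  let ?Y = "mat_pow X (Suc k) ** mat_pow A k"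
  have XA: "X ** mat_pow A (Suc k) = mat_pow A k" and AXX: "A ** mat_pow X 2 = X"
    using X by (auto simp: core_ep_at_def)
  have YA: "?Y ** A = mat_pow X (Suc k) ** mat_pow A (Suc k)"
    by (simp only: mat_pow_Suc_right[of A] matrix_mul_assoc)
  have "A ** ?Y = A ** mat_pow X (Suc k) ** (X ** mat_pow A (Suc k))"
    by (simp only: XA matrix_mul_assoc)
  also have "\<dots> = A ** mat_pow X 2 ** mat_pow X k ** mat_pow A (Suc k)"
    by (metis mat_pow.simps(2) mat_pow_Suc_right mat_pow_two matrix_mul_assoc)
  also have "\<dots> = ?Y ** A"
    unfolding AXX YA by simp
  finally have comm: "A ** ?Y = ?Y ** A" .
  have AXB: "A ** X ** mat_pow A k = mat_pow A k"
  proof -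
    have "A ** X ** mat_pow A k = A ** mat_pow X 2 ** mat_pow A (Suc k)"
      by (metis XA mat_pow_two matrix_mul_assoc)
    then show ?thesis by (simp only: AXX XA)
  qed
  have "?Y ** A ** ?Y = mat_pow X (Suc k) ** (mat_pow A (Suc k) ** mat_pow X (Suc k)) ** mat_pow A k"
    by (simp only: YA matrix_mul_assoc)
  also have "mat_pow A (Suc k) ** mat_pow X (Suc k) = A ** X"
    using AXX by (rule mult_eq_mat_pow_mult_mat_pow) simp
  also have "mat_pow X (Suc k) ** (A ** X) ** mat_pow A k = ?Y"
    by (metis AXB matrix_mul_assoc)
  finally have outer: "?Y ** A ** ?Y = ?Y" .
  have "?Y ** mat_pow A (Suc k) = mat_pow X (Suc k) ** mat_pow A (k + Suc k)"
    by (simp only: mat_pow_add matrix_mul_assoc)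
  also have "\<dots> = mat_pow A k"
    using XA by (rule mat_pow_cancel_left)
  finally show ?thesis
    using outer comm by (simp add: drazin_at_def)
qed

text \<open>Both candidates equal \<open>Y A Z\<close>: each is divisible by arbitrarily high powers of
  \<open>A\<close>, on which the other one cancels.\<close>

lemma drazin_at_unique:
  assumes Y: "drazin_at k A Y" and Z: "drazin_at k A Z"
  shows "Y = Z"
proof -
  have right: "Y' = mat_pow A n ** mat_pow Y' (Suc n)"
    and left: "Y' = mat_pow Y' (Suc n) ** mat_pow A n" if "drazin_at k A Y'" for Y' n
  proof -
    have c: "A ** Y' = Y' ** A" and o: "Y' ** A ** Y' = Y'" using that by (auto simp: drazin_at_def)
    show "Y' = mat_pow A n ** mat_pow Y' (Suc n)"
      using c o by (intro mat_pow_mult_mat_pow_Suc[symmetric]) (simp add: mat_pow_two matrix_mul_assoc)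
    show "Y' = mat_pow Y' (Suc n) ** mat_pow A n"
    proof (induction n)
      case (Suc n)
      have "Y' ** Y' ** A = Y'" using c o by (metis matrix_mul_assoc)
      then show ?case
        using Suc by (metis mat_pow.simps(2) mat_pow_Suc_right matrix_mul_assoc)
    qed simp
  qed
  have YA: "Y ** mat_pow A (Suc k) = mat_pow A k" using Y by (simp add: drazin_at_def)
  have AZ: "mat_pow A (Suc k) ** Z = mat_pow A k"
  proof -
    have comm: "A ** Z = Z ** A" using Z by (simp add: drazin_at_def)
    have "mat_pow A n ** Z = Z ** mat_pow A n" for n
    proof (induction n)
      case (Suc n)
      have "mat_pow A (Suc n) ** Z = A ** (mat_pow A n ** Z)"
        by (simp only: mat_pow.simps matrix_mul_assoc)
      also have "\<dots> = Z ** mat_pow A (Suc n)"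
        by (simp only: Suc mat_pow.simps matrix_mul_assoc comm)
      finally show ?case .
    qed simp
    then have "mat_pow A (Suc k) ** Z = Z ** mat_pow A (Suc k)" .
    also have "\<dots> = mat_pow A k"
      using Z by (simp only: drazin_at_def)
    finally show ?thesis .
  qed
  have "Y = mat_pow Y (Suc k) ** mat_pow A k"
    by (rule left[OF Y])
  also have "\<dots> = (mat_pow Y (Suc k) ** mat_pow A k) ** A ** Z"
    using AZ by (simp only: mat_pow_Suc_right matrix_mul_assoc[symmetric])
  also have "\<dots> = Y ** A ** Z"
    by (simp only: left[OF Y, of k, symmetric])
  also have "\<dots> = Y ** A ** (mat_pow A k ** mat_pow Z (Suc k))"
    by (simp only: right[OF Z, of k, symmetric])
  also have "\<dots> = (Y ** mat_pow A (Suc k)) ** mat_pow Z (Suc k)"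
    by (simp only: mat_pow.simps(2)[of A] matrix_mul_assoc)
  also have "\<dots> = mat_pow A k ** mat_pow Z (Suc k)"
    by (simp only: YA)
  also have "\<dots> = Z"
    by (rule right[OF Z, symmetric])
  finally show ?thesis .
qed

section \<open>Passing to the frontal slices\<close>

lemma tensor_eq_iff_tslice:
  assumes "invertible M"
  shows "A = B \<longleftrightarrow> (\<forall>i. tslice M A i = tslice M B i)"
  using ex1_tslice[OF assms, of "tslice M B"] by blast

lemma tslice_mprod:
  assumes "invertible M"
  shows "tslice M (A \<star>\<^bsub>M\<^esub> B) i = tslice M A i ** tslice M B i"
  using theI'[OF ex1_tslice[OF assms, of "\<lambda>i. tslice M A i ** tslice M B i"]]
  unfolding mprod_def by blast

lemma tslice_tensor_id:
  assumes "invertible M"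
  shows "tslice M (tensor_id M) i = mat 1"
  using theI'[OF ex1_tslice[OF assms, of "\<lambda>i. mat 1"]]
  unfolding tensor_id_def by blast

lemma tslice_conj_transpose:
  assumes "invertible M"
  shows "tslice M (tensor_conj_transpose M A) i = mat_conj_transpose (tslice M A i)"
  using theI'[OF ex1_tslice[OF assms, of "\<lambda>i. mat_conj_transpose (tslice M A i)"]]
  unfolding tensor_conj_transpose_def by blast

lemma tslice_tensor_pow:
  assumes "invertible M"
  shows "tslice M (tensor_pow M A n) i = mat_pow (tslice M A i) n"
  by (induction n) (simp_all add: tslice_tensor_id[OF assms] tslice_mprod[OF assms])

lemmas tslice_simps = tensor_eq_iff_tslice tslice_mprod tslice_conj_transpose tslice_tensor_pow

lemma is_core_ep_inverse_iff_tslice: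
  assumes "invertible M"
  shows "is_core_ep_inverse M A X \<longleftrightarrow>
    (\<forall>i. core_ep_at (tubal_index M A) (tslice M A i) (tslice M X i))"
  by (auto simp: is_core_ep_inverse_def core_ep_at_def Let_def tslice_simps[OF assms])

lemma is_drazin_inverse_iff_tslice:
  assumes "invertible M"
  shows "is_drazin_inverse M A Y \<longleftrightarrow>
    (\<forall>i. drazin_at (tubal_index M A) (tslice M A i) (tslice M Y i))"
  by (auto simp: is_drazin_inverse_def drazin_at_def Let_def tslice_simps[OF assms])

lemma mat_index_le_tubal_index: "mat_index (tslice M A i) \<le> tubal_index M A"
  by (simp add: tubal_index_def)

lemma ex1_core_ep_inverse:
  assumes "invertible M"
  shows "\<exists>!X. is_core_ep_inverse M A X"
proof -
  have "\<forall>i. \<exists>x. core_ep_at (tubal_index M A) (tslice M A i) x"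
    using ex_core_ep_at mat_index_le_tubal_index by blast
  then obtain F where "\<And>i. core_ep_at (tubal_index M A) (tslice M A i) (F i)"
    by metis
  then have "\<exists>X. is_core_ep_inverse M A X"
    using ex1_tslice[OF assms, of F] by (metis is_core_ep_inverse_iff_tslice[OF assms])
  then show ?thesis
    using core_ep_at_unique
    by (metis is_core_ep_inverse_iff_tslice[OF assms] tensor_eq_iff_tslice[OF assms])
qed

lemma drazin_inverse_eqI:
  assumes "invertible M" and "is_drazin_inverse M A Y"
  shows "drazin_inverse M A = Y"
  unfolding drazin_inverse_def
proof (rule the_equality)
  show "Y' = Y" if "is_drazin_inverse M A Y'" for Y'
    using that assms drazin_at_unique
    by (metis is_drazin_inverse_iff_tslice tensor_eq_iff_tslice)
qed (rule assms(2))

theorem theorem4p5: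
  fixes M :: "complex^'p^'p" and A X :: "complex^'p^'m^'m" and k :: nat
  assumes "invertible M"
    and "tubal_index M A = k"
    and "X = core_ep_inverse M A"
  shows "(\<forall>n>0. A \<star>\<^bsub>M\<^esub> X = tensor_pow M A n \<star>\<^bsub>M\<^esub> tensor_pow M X n) \<and>
         (\<forall>n>0. X = tensor_pow M A n \<star>\<^bsub>M\<^esub> tensor_pow M X (n + 1)) \<and>
         X \<star>\<^bsub>M\<^esub> A \<star>\<^bsub>M\<^esub> X = X \<and>
         tensor_pow M X (k + 1) \<star>\<^bsub>M\<^esub> tensor_pow M A k = drazin_inverse M A"
proof (intro conjI allI impI)
  note inv = assms(1)
  have "is_core_ep_inverse M A X"
    using theI'[OF ex1_core_ep_inverse[OF inv, of A]] assms(3) by (simp add: core_ep_inverse_def)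
  then have cep: "core_ep_at k (tslice M A i) (tslice M X i)" for i
    using is_core_ep_inverse_iff_tslice[OF inv] assms(2) by blast
  then have AXX: "tslice M A i ** mat_pow (tslice M X i) 2 = tslice M X i" for i
    by (simp add: core_ep_at_def)
  show "A \<star>\<^bsub>M\<^esub> X = tensor_pow M A n \<star>\<^bsub>M\<^esub> tensor_pow M X n" if "n > 0" for n
    using mult_eq_mat_pow_mult_mat_pow[OF AXX that] by (simp add: tslice_simps[OF inv])
  show "X = tensor_pow M A n \<star>\<^bsub>M\<^esub> tensor_pow M X (n + 1)" for n
    using mat_pow_mult_mat_pow_Suc[OF AXX, of _ n]
    by (simp add: tslice_simps[OF inv] del: tensor_pow.simps mat_pow.simps)
  show "X \<star>\<^bsub>M\<^esub> A \<star>\<^bsub>M\<^esub> X = X"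
    using core_ep_at_outer[OF cep] by (simp add: tslice_simps[OF inv])
  have "is_drazin_inverse M A (tensor_pow M X (k + 1) \<star>\<^bsub>M\<^esub> tensor_pow M A k)"
    using core_ep_at_imp_drazin_at[OF cep] assms(2)
    by (simp add: is_drazin_inverse_iff_tslice[OF inv] tslice_simps[OF inv] del: tensor_pow.simps mat_pow.simps)
  then show "tensor_pow M X (k + 1) \<star>\<^bsub>M\<^esub> tensor_pow M A k = drazin_inverse M A"
    by (rule drazin_inverse_eqI[OF inv, symmetric])
qed

end
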